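(* Let $\mathbb{K}$ be a field, let $G$ be a finite bipartite simple graph with vertex partition $X\sqcup Y$ and at least one edge, and let $I(G)$ be its edge ideal in the polynomial ring $R=\mathbb{K}[x,y\mid x\in X,\ y\in Y]$. Then $$\widehat{I(G)}^{[\mathbf{N}]}=(I(G^c))^\star,$$ where $\widehat{I(G)}^{[\mathbf{N}]}$ is the Newton complementary dual of $I(G)$, $G^c$ is the essential complement of $G$, and $(\cdot)^\star$ denotes the Alexander dual.
   Context: The edge ideal $I(G)$ of a finite simple graph $G$ (vertices identified with variables) is the ideal of $R$ generated by the products $uv$ over all edges $\{u,v\}$ of $G$. For a nonzero monomial ideal $I$ with minimal monomial generating set $G(I)$, the Newton complementary dual $\widehat{I}^{[\mathbf{N}]}$ is the monomial ideal with minimal monomial generating set $\{\operatorname{lcm}(G(I))/f\mid f\in G(I)\}$. For the bipartite graph $G$ put $X_I=\{x\in X\mid \deg_G(x)\ge 1\}$ and $Y_I=\{y\in Y\mid \deg_G(y)\ge 1\}$. The essential complement $G^c$ is the complement, with respect to the vertex set $X_I\sqcup Y_I$, of the induced subgraph $G|_{X_I\sqcup Y_I}$: its vertex set is $X_I\sqcup Y_I$, and two distinct vertices are adjacent in $G^c$ if and only if they are not adjacent in $G$ (so in particular any two distinct vertices of $X_I$, and any two distinct vertices of $Y_I$, are adjacent in $G^c$). Its edge ideal $I(G^c)$ is taken in $R$. For a squarefree monomial ideal $J\subseteq R$ with minimal monomial generators $\mathbf{x}^{\sigma_1},\dots,\mathbf{x}^{\sigma_r}$, where $\mathbf{x}^{\sigma}=\prod_{v\in\sigma}v$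 for a set $\sigma$ of variables, the Alexander dual is $J^\star=\mathfrak{p}_{\sigma_1}\cap\cdots\cap\mathfrak{p}_{\sigma_r}$, where $\mathfrak{p}_\sigma=(v\mid v\in\sigma)$. The empty intersection is $R$, i.e. $0^\star=R$. *)

theory Defs
  imports Complex_Main "HOL-Library.Poly_Mapping"
begin

section \<open>Monomial ideals in a polynomial ring\<close>

text \<open>The polynomial ring over \<open>'k\<close> whose variables are the elements of \<open>'v\<close>. Monomials are
  given by their exponent vectors, of type \<open>'v \<Rightarrow>\<^sub>0 nat\<close>; an ideal is a set of polynomials.\<close>

type_synonym ('v, 'k) mpoly = "('v \<Rightarrow>\<^sub>0 nat) \<Rightarrow>\<^sub>0 'k"

definition monom :: "('v \<Rightarrow>\<^sub>0 nat) \<Rightarrow> ('v, 'k::field) mpoly" where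
  "monom a = Poly_Mapping.single a 1"

definition var :: "'v \<Rightarrow> ('v, 'k::field) mpoly" where
  "var v = monom (Poly_Mapping.single v 1)"

text \<open>The ideal generated by \<open>S\<close> is the span of \<open>S\<close> in the ring, viewed as a module over itself.\<close>

definition ideal_gen :: "'r::comm_ring_1 set \<Rightarrow> 'r set" where
  "ideal_gen S = module.span (*) S"

definition is_min_gens :: "('v, 'k::field) mpoly set \<Rightarrow> ('v \<Rightarrow>\<^sub>0 nat) set \<Rightarrow> bool" where
  "is_min_gens I A \<longleftrightarrow>
     ideal_gen (monom ` A) = I \<and> (\<forall>B. B \<subset> A \<longrightarrow> ideal_gen (monom ` B) \<noteq> I)"

text \<open>The minimal monomial generating set \<open>G(I)\<close> of a monomial ideal, as a set of exponent vectors.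
  It exists and is unique, see \<open>min_gens_unique\<close> below.\<close>

definition min_gens :: "('v, 'k::field) mpoly set \<Rightarrow> ('v \<Rightarrow>\<^sub>0 nat) set" where
  "min_gens I = (THE A. is_min_gens I A)"

text \<open>The exponent vector of the least common multiple of finitely many (at least one) monomials.\<close>

definition lcm_exp :: "('v::finite \<Rightarrow>\<^sub>0 nat) set \<Rightarrow> ('v \<Rightarrow>\<^sub>0 nat)" where
  "lcm_exp A = Abs_poly_mapping (\<lambda>v. Max ((\<lambda>a. Poly_Mapping.lookup a v) ` A))"

text \<open>Each minimal generator divides the least common multiple, so the truncated difference of
  exponents is the exact quotient of monomials.\<close>

definition newton_dual :: "('v::finite, 'k::field) mpoly set \<Rightarrow> ('v, 'k) mpoly set" where
  "newton_dual I = ideal_gen {monom (lcm_exp (min_gens I) - a) | a. a \<in> min_gens I}"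

text \<open>Meant for squarefree \<open>J\<close>: \<open>\<sigma>\<close> then runs over the supports of all minimal generators.
  The intersection over the empty family is \<open>UNIV\<close>, the whole ring.\<close>

definition alexander_dual :: "('v::finite, 'k::field) mpoly set \<Rightarrow> ('v, 'k) mpoly set" where
  "alexander_dual J =
     \<Inter> {ideal_gen (var ` \<sigma>) | \<sigma>. (\<Prod>v\<in>\<sigma>. var v) \<in> (monom ` min_gens J :: ('v, 'k) mpoly set)}"


section \<open>Graphs and edge ideals\<close>

record 'v ugraph =
  vertices :: "'v set"
  edges :: "'v set set"

definition finite_simple_graph :: "'v ugraph \<Rightarrow> bool" where
  "finite_simple_graph G \<longleftrightarrow>
     finite (vertices G) \<and> (\<forall>e\<in>edges G. e \<subseteq> vertices G \<and> card e = 2)"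

definition bipartition :: "'v ugraph \<Rightarrow> 'v set \<Rightarrow> 'v set \<Rightarrow> bool" where
  "bipartition G X Y \<longleftrightarrow>
     X \<union> Y = vertices G \<and> X \<inter> Y = {} \<and> (\<forall>e\<in>edges G. \<exists>x\<in>X. \<exists>y\<in>Y. e = {x, y})"

definition degree :: "'v ugraph \<Rightarrow> 'v \<Rightarrow> nat" where
  "degree G v = card {e \<in> edges G. v \<in> e}"

definition induced_subgraph :: "'v ugraph \<Rightarrow> 'v set \<Rightarrow> 'v ugraph" where
  "induced_subgraph G W = \<lparr>vertices = W, edges = {e \<in> edges G. e \<subseteq> W}\<rparr>"

definition graph_complement :: "'v ugraph \<Rightarrow> 'v ugraph" where
  "graph_complement G =
     \<lparr>vertices = vertices G,
      edges = {{u, v} | u v. u \<in> vertices G \<and> v \<in> vertices G \<and> u \<noteq> v \<and> {u, v} \<notin> edges G}\<rparr>"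

definition essential_complement :: "'v ugraph \<Rightarrow> 'v set \<Rightarrow> 'v set \<Rightarrow> 'v ugraph" where
  "essential_complement G X Y =
     graph_complement
       (induced_subgraph G ({x \<in> X. degree G x \<ge> 1} \<union> {y \<in> Y. degree G y \<ge> 1}))"

definition edge_ideal :: "'v ugraph \<Rightarrow> ('v, 'k::field) mpoly set" where
  "edge_ideal G = ideal_gen {var u * var v | u v. {u, v} \<in> edges G}"


section \<open>Well-definedness of the minimal monomial generating set\<close>

lemma module_times: "module ((*) :: 'r::comm_ring_1 \<Rightarrow> 'r \<Rightarrow> 'r)"
  by unfold_locales (simp_all add: algebra_simps)

lemma keys_ideal_gen_monom:
  fixes p :: "('v, 'k::field) mpoly"
  assumes "p \<in> ideal_gen (monom ` A)" "m \<in> Poly_Mapping.keys p"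
  shows "\<exists>a\<in>A. \<exists>c. m = c + a"
proof -
  have "p \<in> module.span (*) (monom ` A)" using assms(1) by (simp add: ideal_gen_def)
  then have "\<forall>m\<in>Poly_Mapping.keys p. \<exists>a\<in>A. \<exists>c. m = c + a"
  proof (induction rule: module.span_induct_alt[OF module_times, consumes 1, case_names zero step])
    case zero
    then show ?case by simp
  next
    case (step c x y)
    then obtain a where a: "a \<in> A" "x = monom a" by blast
    show ?case
    proof
      fix m assume "m \<in> Poly_Mapping.keys (c * x + y)"
      then have "m \<in> Poly_Mapping.keys (c * x) \<or> m \<in> Poly_Mapping.keys y" using keys_add[of "c * x" y] by blast
      then show "\<exists>a\<in>A. \<exists>c. m = c + a"
      proof
        assume "m \<in> Poly_Mapping.keys (c * x)"
        then obtain s t where "m = s + t" "t \<in> Poly_Mapping.keys x"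
          using keys_mult[of c x] by auto
        moreover have "Poly_Mapping.keys x = {a}" by (simp add: a(2) monom_def)
        ultimately show ?thesis using a(1) by auto
      qed (use step in blast)
    qed
  qed
  then show ?thesis using assms(2) by blast
qed

lemma ideal_gen_base: "x \<in> S \<Longrightarrow> x \<in> ideal_gen S"
  unfolding ideal_gen_def by (rule module.span_base[OF module_times])

lemma monom_add_in_ideal_gen:
  fixes S :: "('v, 'k::field) mpoly set"
  assumes "monom a \<in> ideal_gen S"
  shows "monom (c + a) \<in> ideal_gen S"
proof -
  have "(monom (c + a) :: ('v, 'k) mpoly) = monom c * monom a" by (simp add: monom_def mult_single)
  moreover have "monom c * monom a \<in> ideal_gen S"
    using assms unfolding ideal_gen_def by (rule module.span_scale[OF module_times])
  ultimately show ?thesis by simp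
qed

lemma ideal_gen_subsetI: "S \<subseteq> ideal_gen T \<Longrightarrow> ideal_gen S \<subseteq> ideal_gen T"
  unfolding ideal_gen_def
  by (simp add: module.span_minimal[OF module_times] module.subspace_span[OF module_times])

lemma monom_in_ideal_gen_iff:
  "(monom m :: ('v, 'k::field) mpoly) \<in> ideal_gen (monom ` A) \<longleftrightarrow> (\<exists>a\<in>A. \<exists>c. m = c + a)"
proof
  assume "(monom m :: ('v, 'k) mpoly) \<in> ideal_gen (monom ` A)"
  from keys_ideal_gen_monom[OF this, of m] show "\<exists>a\<in>A. \<exists>c. m = c + a" by (simp add: monom_def)
next
  assume "\<exists>a\<in>A. \<exists>c. m = c + a"
  then show "(monom m :: ('v, 'k) mpoly) \<in> ideal_gen (monom ` A)"
    by (auto intro: monom_add_in_ideal_gen ideal_gen_base)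
qed

definition exp_size :: "('v \<Rightarrow>\<^sub>0 nat) \<Rightarrow> nat" where
  "exp_size a = (\<Sum>v\<in>Poly_Mapping.keys a. Poly_Mapping.lookup a v)"

lemma exp_size_add: "exp_size (a + b) = exp_size a + exp_size b"
proof -
  let ?K = "Poly_Mapping.keys a \<union> Poly_Mapping.keys b"
  have eq: "exp_size d = (\<Sum>v\<in>?K. Poly_Mapping.lookup d v)" if "Poly_Mapping.keys d \<subseteq> ?K" for d
    unfolding exp_size_def using that by (intro sum.mono_neutral_left) (auto simp: in_keys_iff)
  show ?thesis
    using keys_add[of a b] by (simp add: eq lookup_add sum.distrib)
qed

lemma exp_size_0: "exp_size a = 0 \<Longrightarrow> a = 0"
  by (rule poly_mapping_eqI) (auto simp: exp_size_def in_keys_iff)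

theorem min_gens_unique:
  fixes I :: "('v, 'k::field) mpoly set"
  assumes I: "I = ideal_gen (monom ` S)"
  shows "\<exists>!A. is_min_gens I A"
proof -
  define M where "M = {m \<in> S. \<forall>s\<in>S. \<forall>c. m = c + s \<longrightarrow> c = 0}"
  have M_S: "M \<subseteq> S" by (auto simp: M_def)
  have below: "\<exists>m\<in>M. \<exists>c. s = c + m" if "s \<in> S" for s
    using that
  proof (induction "exp_size s" arbitrary: s rule: less_induct)
    case less
    show ?case
    proof (cases "s \<in> M")
      case True
      then show ?thesis by (metis add_0)
    next
      case False
      then obtain t c where t: "t \<in> S" "s = c + t" "c \<noteq> 0" using less.prems by (auto simp: M_def)
      then have "exp_size t < exp_size s" using exp_size_0[of c] by (auto simp: exp_size_add)
      then obtain m d where "m \<in> M" "t = d + m" using less.hyps t(1) by blast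
      then have "s = (c + d) + m" using t(2) by (simp add: add.assoc)
      then show ?thesis using \<open>m \<in> M\<close> by blast
    qed
  qed
  have min: "c = 0" if m: "m \<in> M" "m = c + n" and n: "monom n \<in> I" for m n c
  proof -
    obtain s d where "s \<in> S" "n = d + s" using n monom_in_ideal_gen_iff I by blast
    then have "m = (c + d) + s" using m(2) by (simp add: add.assoc)
    then have "c + d = 0" using m(1) \<open>s \<in> S\<close> by (auto simp: M_def)
    then have "exp_size c = 0" using exp_size_add[of c d] by (simp add: exp_size_def)
    then show ?thesis by (rule exp_size_0)
  qed
  have gen: "ideal_gen (monom ` M) = I"
  proof
    show "ideal_gen (monom ` M) \<subseteq> I"
      unfolding I using M_S by (intro ideal_gen_subsetI) (auto intro: ideal_gen_base)
    show "I \<subseteq> ideal_gen (monom ` M)"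
      unfolding I using below by (intro ideal_gen_subsetI) (auto simp: monom_in_ideal_gen_iff)
  qed
  have sub: "M \<subseteq> A" if A: "ideal_gen (monom ` A) = I" for A
  proof
    fix m assume m: "m \<in> M"
    then have "monom m \<in> I" using gen by (auto intro: ideal_gen_base)
    then obtain a c where a: "a \<in> A" "m = c + a" using monom_in_ideal_gen_iff A by blast
    have "monom a \<in> I" using a(1) A by (auto intro: ideal_gen_base)
    then have "c = 0" using min m a(2) by blast
    then show "m \<in> A" using a by simp
  qed
  show ?thesis
  proof (rule ex1I[of _ M])
    show "is_min_gens I M" unfolding is_min_gens_def using gen sub by blast
    show "A = M" if "is_min_gens I A" for A
      using that gen sub unfolding is_min_gens_def by blast
  qed
qed

end

theory Submission
  imports Defs
begin

text \<open>Membership in a monomial ideal is decided monomial by monomial, so both ideals are compared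
  through the supports of their monomials. Let \<open>W\<close> be the set of non-isolated vertices. A monomial
  with support \<open>T\<close> lies in the Newton dual iff \<open>W - e \<subseteq> T\<close> for some edge \<open>e\<close>, that is, iff \<open>W - T\<close>
  is contained in an edge. It lies in the Alexander dual iff \<open>T\<close> meets every edge of \<open>G\<^sup>c\<close>, that is,
  iff \<open>W - T\<close> is a clique of \<open>G\<close>. In a bipartite graph a clique has at most two vertices, and as
  no vertex of \<open>W\<close> is isolated, it is then contained in an edge.\<close>

section \<open>Squarefree monomials encoded by their supports\<close>

text \<open>Exponent vector of the squarefree monomial with support \<open>s\<close>. For infinite
  \<open>s\<close> the sum defaults to 0, hence the finiteness assumptions below.\<close>

definition set_exp :: "'v set \<Rightarrow> ('v \<Rightarrow>\<^sub>0 nat)" where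
  "set_exp s = (\<Sum>v\<in>s. Poly_Mapping.single v 1)"

lemma lookup_set_exp:
  "finite s \<Longrightarrow> Poly_Mapping.lookup (set_exp s) v = (if v \<in> s then 1 else 0)"
  by (simp add: set_exp_def lookup_sum lookup_single when_def)

lemma exponent_add_iff:
  fixes a m :: "'v \<Rightarrow>\<^sub>0 nat"
  shows "(\<exists>c. m = c + a) \<longleftrightarrow> (\<forall>v. Poly_Mapping.lookup a v \<le> Poly_Mapping.lookup m v)"
proof
  assume "\<forall>v. Poly_Mapping.lookup a v \<le> Poly_Mapping.lookup m v"
  then have "m = (m - a) + a"
    by (intro poly_mapping_eqI) (simp add: lookup_add lookup_minus)
  then show "\<exists>c. m = c + a" ..
qed (auto simp: lookup_add)

text \<open>Exponents of \<open>set_exp s\<close> are 0 or 1, so divisibility by this monomial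
  depends only on the support of \<open>m\<close>.\<close>

lemma set_exp_add_iff:
  assumes "finite s"
  shows "(\<exists>c. m = c + set_exp s) \<longleftrightarrow> s \<subseteq> Poly_Mapping.keys m"
  unfolding exponent_add_iff by (auto simp: lookup_set_exp assms in_keys_iff Suc_le_eq)

lemma keys_set_exp: "finite s \<Longrightarrow> Poly_Mapping.keys (set_exp s) = s"
  by (auto simp: in_keys_iff lookup_set_exp split: if_splits)

lemma set_exp_diff:
  assumes "finite s" "finite t"
  shows "set_exp s - set_exp t = set_exp (s - t)"
  using assms by (intro poly_mapping_eqI) (simp add: lookup_minus lookup_set_exp)

lemma prod_var:
  "finite s \<Longrightarrow> (\<Prod>v\<in>s. var v :: ('v, 'k::field) mpoly) = monom (set_exp s)"
proof (induction s rule: finite_induct)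
  case empty
  then show ?case by (simp add: set_exp_def monom_def)
next
  case (insert x s)
  then show ?case by (simp add: set_exp_def var_def monom_def mult_single)
qed

lemma monom_eq_iff: "(monom a :: ('v, 'k::field) mpoly) = monom b \<longleftrightarrow> a = b"
proof
  assume "(monom a :: ('v, 'k) mpoly) = monom b"
  then have "Poly_Mapping.keys (monom a :: ('v, 'k) mpoly) = Poly_Mapping.keys (monom b :: ('v, 'k) mpoly)"
    by simp
  then show "a = b" by (simp add: monom_def)
qed simp

section \<open>Membership and minimal generators of monomial ideals\<close>

lemma sum_single_lookup:
  "(\<Sum>m\<in>Poly_Mapping.keys p. Poly_Mapping.single m (Poly_Mapping.lookup p m)) = p"
  by (rule poly_mapping_eqI) (simp add: lookup_sum lookup_single when_def in_keys_iff)

text \<open>The converse of \<open>keys_ideal_gen_monom\<close> holds because \<open>p\<close> is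
  the sum of its terms, each a scalar multiple of a monomial in the ideal.\<close>

lemma in_ideal_gen_monom_iff:
  fixes p :: "('v, 'k::field) mpoly"
  shows "p \<in> ideal_gen (monom ` A) \<longleftrightarrow> (\<forall>m\<in>Poly_Mapping.keys p. \<exists>a\<in>A. \<exists>c. m = c + a)"
proof
  assume R: "\<forall>m\<in>Poly_Mapping.keys p. \<exists>a\<in>A. \<exists>c. m = c + a"
  have "(\<Sum>m\<in>Poly_Mapping.keys p. Poly_Mapping.single m (Poly_Mapping.lookup p m))
          \<in> ideal_gen (monom ` A)"
    unfolding ideal_gen_def
  proof (rule module.span_sum[OF module_times])
    fix m assume "m \<in> Poly_Mapping.keys p"
    then have "(monom m :: ('v, 'k) mpoly) \<in> module.span (*) (monom ` A)"
      using R by (simp add: monom_in_ideal_gen_iff flip: ideal_gen_def)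
    \<comment> \<open>The exponent 0 makes this factor the constant polynomial carrying the
      coefficient of \<open>m\<close>.\<close>
    then have "Poly_Mapping.single 0 (Poly_Mapping.lookup p m) * monom m
                 \<in> module.span (*) (monom ` A)"
      by (rule module.span_scale[OF module_times])
    then show "Poly_Mapping.single m (Poly_Mapping.lookup p m) \<in> module.span (*) (monom ` A)"
      by (simp add: monom_def mult_single)
  qed
  then show "p \<in> ideal_gen (monom ` A)" by (simp add: sum_single_lookup)
qed (use keys_ideal_gen_monom in blast)

lemma in_ideal_gen_set_exp_iff:
  fixes p :: "('v::finite, 'k::field) mpoly"
  shows "p \<in> ideal_gen (monom ` set_exp ` S) \<longleftrightarrow>
    (\<forall>m\<in>Poly_Mapping.keys p. \<exists>s\<in>S. s \<subseteq> Poly_Mapping.keys m)"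
  by (simp add: in_ideal_gen_monom_iff set_exp_add_iff)

lemma in_ideal_gen_var_iff:
  fixes p :: "('v::finite, 'k::field) mpoly"
  shows "p \<in> ideal_gen (var ` s) \<longleftrightarrow> (\<forall>m\<in>Poly_Mapping.keys p. s \<inter> Poly_Mapping.keys m \<noteq> {})"
proof -
  have "(var ` s :: ('v, 'k) mpoly set) = monom ` set_exp ` (\<lambda>v. {v}) ` s"
    by (simp add: image_image var_def set_exp_def)
  then show ?thesis by (auto simp: in_ideal_gen_set_exp_iff)
qed

text \<open>If no monomial of \<open>A\<close> properly divides another, dropping one of them
  removes it from the ideal. Uniqueness then identifies \<open>A\<close> with the value of
  \<open>THE\<close>.\<close>

lemma min_gens_antichain:
  assumes "\<And>a b c. a \<in> A \<Longrightarrow> b \<in> A \<Longrightarrow> a = c + b \<Longrightarrow> a = b"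
  shows "min_gens (ideal_gen (monom ` A) :: ('v, 'k::field) mpoly set) = A"
proof -
  let ?I = "ideal_gen (monom ` A) :: ('v, 'k) mpoly set"
  have "is_min_gens ?I A"
    unfolding is_min_gens_def
  proof (intro conjI allI impI notI refl)
    fix B assume B: "B \<subset> A" and eq: "ideal_gen (monom ` B) = ?I"
    then obtain a where a: "a \<in> A" "a \<notin> B" by blast
    then have "(monom a :: ('v, 'k) mpoly) \<in> ideal_gen (monom ` B)"
      unfolding eq by (auto intro: ideal_gen_base)
    then obtain b c where b: "b \<in> B" "a = c + b" unfolding monom_in_ideal_gen_iff by blast
    then have "a = b" using assms[of a b c] a(1) B by blast
    then show False using a(2) b(1) by simp
  qed
  then show ?thesis
    unfolding min_gens_def by (rule the1_equality[OF min_gens_unique[OF refl]])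
qed

section \<open>Edge ideals and their two duals\<close>

text \<open>Edges of size two exclude \<open>u = v\<close>, so every generating product is
  squarefree.\<close>

lemma edge_ideal_eq:
  assumes "\<forall>e\<in>edges H. card e = 2"
  shows "(edge_ideal H :: ('v, 'k::field) mpoly set) = ideal_gen (monom ` set_exp ` edges H)"
proof -
  have prod: "(var u * var v :: ('v, 'k) mpoly) = monom (set_exp {u, v})" if "{u, v} \<in> edges H" for u v
  proof -
    have "u \<noteq> v" using assms that by force
    then show ?thesis using prod_var[of "{u, v}", where 'k = 'k] by simp
  qed
  have "{var u * var v :: ('v, 'k) mpoly | u v. {u, v} \<in> edges H} = monom ` set_exp ` edges H"
  proof
    show "{var u * var v :: ('v, 'k) mpoly | u v. {u, v} \<in> edges H} \<subseteq> monom ` set_exp ` edges H"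
      using prod by auto
    show "monom ` set_exp ` edges H \<subseteq> {var u * var v :: ('v, 'k) mpoly | u v. {u, v} \<in> edges H}"
    proof
      fix p :: "('v, 'k) mpoly" assume "p \<in> monom ` set_exp ` edges H"
      then obtain e where e: "e \<in> edges H" "p = monom (set_exp e)" by auto
      obtain u v where "e = {u, v}" using assms e(1) by (auto simp: card_2_iff)
      then have "p = var u * var v" "{u, v} \<in> edges H" using e prod by simp_all
      then show "p \<in> {var u * var v | u v. {u, v} \<in> edges H}" by blast
    qed
  qed
  then show ?thesis by (simp add: edge_ideal_def)
qed

text \<open>All edges have the same finite size, so divisibility between edge monomials forces
  equality.\<close>

lemma min_gens_edge_ideal:
  assumes "\<forall>e\<in>edges H. card e = 2"
  shows "min_gens (edge_ideal H :: ('v, 'k::field) mpoly set) = set_exp ` edges H"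
  unfolding edge_ideal_eq[OF assms]
proof (rule min_gens_antichain)
  fix a b c assume "a \<in> set_exp ` edges H" "b \<in> set_exp ` edges H" "a = c + b"
  then obtain e f where ef: "e \<in> edges H" "f \<in> edges H" "a = set_exp e" "b = set_exp f"
    by blast
  then have ex: "\<exists>c. set_exp e = c + set_exp f"
    using \<open>a = c + b\<close> by blast
  have fin: "finite e" "finite f"
    using assms ef(1,2) by (auto intro: card_ge_0_finite)
  then have "f \<subseteq> e" using ex by (simp add: set_exp_add_iff keys_set_exp)
  then have "f = e" using fin assms ef by (intro card_subset_eq) auto
  then show "a = b" using ef by simp
qed

lemma lcm_exp_set_exp:
  fixes S :: "'v::finite set set"
  assumes "S \<noteq> {}"
  shows "lcm_exp (set_exp ` S) = set_exp (\<Union>S)"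
proof -
  have "Max ((\<lambda>a. Poly_Mapping.lookup a v) ` set_exp ` S) = Poly_Mapping.lookup (set_exp (\<Union>S)) v" for v
    unfolding image_image
  proof (rule Max_eqI)
    \<comment> \<open>For \<open>v\<close> in the union, a member containing \<open>v\<close>
      attains the value 1. Otherwise any member gives 0, and one exists since \<open>S\<close> is
      nonempty.\<close>
    show "Poly_Mapping.lookup (set_exp (\<Union>S)) v \<in> (\<lambda>s. Poly_Mapping.lookup (set_exp s) v) ` S"
      using assms by (cases "v \<in> \<Union>S") (force simp: lookup_set_exp)+
  qed (auto simp: lookup_set_exp)
  then show ?thesis by (simp add: lcm_exp_def)
qed

lemma in_newton_dual_edge_ideal_iff:
  fixes p :: "('v::finite, 'k::field) mpoly"
  assumes card: "\<forall>e\<in>edges H. card e = 2" and "edges H \<noteq> {}"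
  shows "p \<in> newton_dual (edge_ideal H) \<longleftrightarrow>
    (\<forall>m\<in>Poly_Mapping.keys p. \<exists>e\<in>edges H. \<Union>(edges H) - e \<subseteq> Poly_Mapping.keys m)"
proof -
  have "{monom (lcm_exp (min_gens (edge_ideal H :: ('v, 'k) mpoly set)) - a) :: ('v, 'k) mpoly | a.
            a \<in> min_gens (edge_ideal H :: ('v, 'k) mpoly set)}
        = monom ` set_exp ` (\<lambda>e. \<Union>(edges H) - e) ` edges H"
    unfolding min_gens_edge_ideal[OF card] lcm_exp_set_exp[OF assms(2)] setcompr_eq_image
    by (simp add: image_image set_exp_diff)
  then show ?thesis by (simp add: newton_dual_def in_ideal_gen_set_exp_iff)
qed

lemma in_alexander_dual_edge_ideal_iff:
  fixes p :: "('v::finite, 'k::field) mpoly"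
  assumes "\<forall>e\<in>edges H. card e = 2"
  shows "p \<in> alexander_dual (edge_ideal H) \<longleftrightarrow>
    (\<forall>m\<in>Poly_Mapping.keys p. \<forall>e\<in>edges H. e \<inter> Poly_Mapping.keys m \<noteq> {})"
proof -
  \<comment> \<open>Taking \<open>keys\<close> recovers a set from its squarefree monomial, so the
    intersection in the dual runs exactly over the edges.\<close>
  have "(\<Prod>v\<in>s. var v) \<in> (monom ` min_gens (edge_ideal H :: ('v, 'k) mpoly set) :: ('v, 'k) mpoly set)
          \<longleftrightarrow> s \<in> edges H" for s
    by (auto simp: min_gens_edge_ideal[OF assms] prod_var monom_eq_iff image_iff
        dest: arg_cong[of _ _ Poly_Mapping.keys] simp: keys_set_exp)
  then have "p \<in> alexander_dual (edge_ideal H) \<longleftrightarrow>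
      (\<forall>e\<in>edges H. p \<in> ideal_gen (var ` e))"
    by (auto simp: alexander_dual_def)
  then show ?thesis by (auto simp: in_ideal_gen_var_iff)
qed

section \<open>The essential complement and cliques of a bipartite graph\<close>

lemma essential_vertices:
  fixes G :: "'v::finite ugraph"
  assumes "finite_simple_graph G" "bipartition G X Y"
  shows "{x \<in> X. degree G x \<ge> 1} \<union> {y \<in> Y. degree G y \<ge> 1} = \<Union>(edges G)"
proof -
  have "degree G v \<ge> 1 \<longleftrightarrow> v \<in> \<Union>(edges G)" for v
    by (auto simp: degree_def Suc_le_eq card_gt_0_iff)
  moreover have "\<Union>(edges G) \<subseteq> X \<union> Y"
    using assms unfolding finite_simple_graph_def bipartition_def by blast
  ultimately show ?thesis by auto
qed

text \<open>Restricting to the non-isolated vertices discards no edge, so non-adjacency can be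
  tested in \<open>G\<close> itself.\<close>

lemma edges_essential_complement:
  fixes G :: "'v::finite ugraph"
  assumes "finite_simple_graph G" "bipartition G X Y"
  shows "edges (essential_complement G X Y) =
    {{u, v} | u v. u \<in> \<Union>(edges G) \<and> v \<in> \<Union>(edges G) \<and> u \<noteq> v \<and> {u, v} \<notin> edges G}"
  unfolding essential_complement_def essential_vertices[OF assms]
    graph_complement_def induced_subgraph_def by auto

lemma bipartite_clique_iff_subset_edge:
  assumes bip: "bipartition G X Y" and ne: "edges G \<noteq> {}" and T: "T \<subseteq> \<Union>(edges G)"
  shows "(\<forall>u\<in>T. \<forall>v\<in>T. u \<noteq> v \<longrightarrow> {u, v} \<in> edges G) \<longleftrightarrow> (\<exists>e\<in>edges G. T \<subseteq> e)"
proof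
  assume clique: "\<forall>u\<in>T. \<forall>v\<in>T. u \<noteq> v \<longrightarrow> {u, v} \<in> edges G"
  have disj: "X \<inter> Y = {}" and E: "\<And>e. e \<in> edges G \<Longrightarrow> \<exists>x\<in>X. \<exists>y\<in>Y. e = {x, y}"
    using bip by (auto simp: bipartition_def)
  show "\<exists>e\<in>edges G. T \<subseteq> e"
  proof (cases "\<exists>u\<in>T. \<exists>v\<in>T. u \<noteq> v")
    case True
    then obtain u v where uv: "u \<in> T" "v \<in> T" "u \<noteq> v" by blast
    have "w \<in> {u, v}" if "w \<in> T" for w
    proof (rule ccontr)
      assume "w \<notin> {u, v}"
      then have edges: "{u, v} \<in> edges G" "{u, w} \<in> edges G" "{v, w} \<in> edges G"
        using clique uv that by auto
      \<comment> \<open>Two of the three vertices lie in the same part, yet all three pairs are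
        edges.\<close>
      show False using disj E[OF edges(1)] E[OF edges(2)] E[OF edges(3)]
        by (auto simp: doubleton_eq_iff)
    qed
    then have "T \<subseteq> {u, v}" by blast
    moreover have "{u, v} \<in> edges G" using clique uv by simp
    ultimately show ?thesis by blast
  next
    case False
    then consider "T = {}" | u where "T = {u}" by blast
    then show ?thesis
    proof cases
      case 1
      then show ?thesis using ne by auto
    next
      case 2
      \<comment> \<open>The vertex \<open>u\<close> is not isolated, so some edge contains
        it.\<close>
      then show ?thesis using T by auto
    qed
  qed
next
  assume "\<exists>e\<in>edges G. T \<subseteq> e"
  then obtain e where e: "e \<in> edges G" "T \<subseteq> e" by blast
  then obtain x y where "e = {x, y}"
    using bip by (auto simp: bipartition_def)
  \<comment> \<open>Two distinct vertices of \<open>T\<close> exhaust the two-element edge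
    \<open>e\<close>.\<close>
  then have "{u, v} = e" if "u \<in> T" "v \<in> T" "u \<noteq> v" for u v
    using that e(2) by auto
  with e(1) show "\<forall>u\<in>T. \<forall>v\<in>T. u \<noteq> v \<longrightarrow> {u, v} \<in> edges G"
    by metis
qed

text \<open>The assumption \<open>vertices G = UNIV\<close> makes the variables of the ring exactly
  the vertices of \<open>G\<close>.\<close>

theorem proposition4p4:
  fixes G :: "'v::finite ugraph" and X Y :: "'v set"
  assumes "finite_simple_graph G"
    and "bipartition G X Y"
    and "vertices G = UNIV"
    and "edges G \<noteq> {}"
  shows "newton_dual (edge_ideal G :: ('v, 'k::field) mpoly set)
           = alexander_dual (edge_ideal (essential_complement G X Y))"
proof (rule set_eqI)
  fix p :: "('v, 'k) mpoly"
  let ?W = "\<Union>(edges G)" and ?H = "essential_complement G X Y"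
  note edges_H = edges_essential_complement[OF assms(1,2)]
  have card_G: "\<forall>e\<in>edges G. card e = 2"
    using assms(1) by (simp add: finite_simple_graph_def)
  have card_H: "\<forall>e\<in>edges ?H. card e = 2"
    unfolding edges_H by auto
  have cover: "(\<exists>e\<in>edges G. ?W - e \<subseteq> S) \<longleftrightarrow> (\<forall>e\<in>edges ?H. e \<inter> S \<noteq> {})" for S
  proof -
    \<comment> \<open>Both inclusions say that \<open>e\<close> and \<open>S\<close> together cover
      \<open>?W\<close>.\<close>
    have "(\<exists>e\<in>edges G. ?W - e \<subseteq> S) \<longleftrightarrow> (\<exists>e\<in>edges G. ?W - S \<subseteq> e)"
      by blast
    also have "\<dots> \<longleftrightarrow> (\<forall>u\<in>?W - S. \<forall>v\<in>?W - S. u \<noteq> v \<longrightarrow> {u, v} \<in> edges G)"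
      using bipartite_clique_iff_subset_edge[OF assms(2,4), of "?W - S"] by blast
    \<comment> \<open>An edge of \<open>?H\<close> missing \<open>S\<close> is the same as a
      non-adjacent pair of distinct vertices in \<open>?W - S\<close>.\<close>
    also have "\<dots> \<longleftrightarrow> (\<forall>e\<in>edges ?H. e \<inter> S \<noteq> {})"
    proof
      assume clique: "\<forall>u\<in>?W - S. \<forall>v\<in>?W - S. u \<noteq> v \<longrightarrow> {u, v} \<in> edges G"
      show "\<forall>e\<in>edges ?H. e \<inter> S \<noteq> {}"
      proof
        fix e assume "e \<in> edges ?H"
        then obtain u v where "e = {u, v}" "u \<in> ?W" "v \<in> ?W" "u \<noteq> v" "{u, v} \<notin> edges G"
          unfolding edges_H by blast
        then show "e \<inter> S \<noteq> {}" using clique by auto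
      qed
    next
      assume cover: "\<forall>e\<in>edges ?H. e \<inter> S \<noteq> {}"
      show "\<forall>u\<in>?W - S. \<forall>v\<in>?W - S. u \<noteq> v \<longrightarrow> {u, v} \<in> edges G"
      proof (intro ballI impI, rule ccontr)
        fix u v assume uv: "u \<in> ?W - S" "v \<in> ?W - S" "u \<noteq> v" "{u, v} \<notin> edges G"
        then have "{u, v} \<in> edges ?H" unfolding edges_H by auto
        then show False using cover uv by auto
      qed
    qed
    finally show ?thesis .
  qed
  show "p \<in> newton_dual (edge_ideal G) \<longleftrightarrow> p \<in> alexander_dual (edge_ideal ?H)"
    \<comment> \<open>Both memberships are conditions on each monomial \<open>m\<close> of
      \<open>p\<close>, matched by \<open>cover\<close> with the support of \<open>m\<close> as
      \<open>S\<close>.\<close>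
    by (simp only: in_newton_dual_edge_ideal_iff[OF card_G assms(4)]
        in_alexander_dual_edge_ideal_iff[OF card_H] cover)
qed

end
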